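(* Let $K$ be any field. Then there exists a locally nilpotent $K$-algebra $R$ and a ($K$-linear) derivation $D$ of $R$ such that $R[X;D]$ is not Jacobson radical, i.e. $J(R[X;D])\neq R[X;D]$.
   Context: A ring is locally nilpotent if every finitely generated subring is nilpotent. For a derivation $D$ of $R$, $R[X;D]$ is the ring of polynomials $\sum a_iX^i$, $a_i\in R$, with pointwise addition and multiplication determined by $X^iX^j=X^{i+j}$ and $Xa=aX+D(a)$. $J(\cdot)$ denotes the Jacobson radical. *)

theory Defs
  imports Main
begin

record ('k, 'r) kalg =
  carr :: "'r set"
  pls  :: "'r \<Rightarrow> 'r \<Rightarrow> 'r"
  tms  :: "'r \<Rightarrow> 'r \<Rightarrow> 'r"
  zr   :: "'r"
  sm   :: "'k \<Rightarrow> 'r \<Rightarrow> 'r"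

definition is_kalg :: "('k::field, 'r) kalg \<Rightarrow> bool" where
  "is_kalg R \<longleftrightarrow>
     zr R \<in> carr R \<and>
     (\<forall>a\<in>carr R. \<forall>b\<in>carr R. pls R a b \<in> carr R \<and> tms R a b \<in> carr R) \<and>
     (\<forall>c. \<forall>a\<in>carr R. sm R c a \<in> carr R) \<and>
     (\<forall>a\<in>carr R. \<forall>b\<in>carr R. \<forall>d\<in>carr R. pls R (pls R a b) d = pls R a (pls R b d)) \<and>
     (\<forall>a\<in>carr R. \<forall>b\<in>carr R. pls R a b = pls R b a) \<and>
     (\<forall>a\<in>carr R. pls R (zr R) a = a) \<and>
     (\<forall>a\<in>carr R. \<exists>b\<in>carr R. pls R a b = zr R) \<and>
     (\<forall>a\<in>carr R. \<forall>b\<in>carr R. \<forall>d\<in>carr R. tms R (tms R a b) d = tms R a (tms R b d)) \<and>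
     (\<forall>a\<in>carr R. \<forall>b\<in>carr R. \<forall>d\<in>carr R. tms R a (pls R b d) = pls R (tms R a b) (tms R a d)) \<and>
     (\<forall>a\<in>carr R. \<forall>b\<in>carr R. \<forall>d\<in>carr R. tms R (pls R a b) d = pls R (tms R a d) (tms R b d)) \<and>
     (\<forall>c. \<forall>a\<in>carr R. \<forall>b\<in>carr R. sm R c (pls R a b) = pls R (sm R c a) (sm R c b)) \<and>
     (\<forall>c e. \<forall>a\<in>carr R. sm R (c + e) a = pls R (sm R c a) (sm R e a)) \<and>
     (\<forall>c e. \<forall>a\<in>carr R. sm R (c * e) a = sm R c (sm R e a)) \<and>
     (\<forall>a\<in>carr R. sm R 1 a = a) \<and>
     (\<forall>c. \<forall>a\<in>carr R. \<forall>b\<in>carr R.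
        sm R c (tms R a b) = tms R (sm R c a) b \<and> sm R c (tms R a b) = tms R a (sm R c b))"

definition is_derivation :: "('k::field, 'r) kalg \<Rightarrow> ('r \<Rightarrow> 'r) \<Rightarrow> bool" where
  "is_derivation R D \<longleftrightarrow>
     (\<forall>a\<in>carr R. D a \<in> carr R) \<and>
     (\<forall>a\<in>carr R. \<forall>b\<in>carr R. D (pls R a b) = pls R (D a) (D b)) \<and>
     (\<forall>a\<in>carr R. \<forall>b\<in>carr R. D (tms R a b) = pls R (tms R (D a) b) (tms R a (D b))) \<and>
     (\<forall>c. \<forall>a\<in>carr R. D (sm R c a) = sm R c (D a))"

definition subring_gen :: "('k, 'r) kalg \<Rightarrow> 'r set \<Rightarrow> 'r set" where
  "subring_gen R F = \<Inter> {S. F \<subseteq> S \<and> S \<subseteq> carr R \<and> zr R \<in> S \<and>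
       (\<forall>a\<in>S. \<forall>b\<in>S. pls R a b \<in> S \<and> tms R a b \<in> S) \<and>
       (\<forall>a\<in>S. \<forall>b\<in>carr R. pls R a b = zr R \<longrightarrow> b \<in> S)}"

definition nilpotent_set :: "('k, 'r) kalg \<Rightarrow> 'r set \<Rightarrow> bool" where
  "nilpotent_set R S \<longleftrightarrow>
     (\<exists>n. \<forall>x xs. x \<in> S \<longrightarrow> set xs \<subseteq> S \<longrightarrow> length xs = n \<longrightarrow> foldl (tms R) x xs = zr R)"

definition locally_nilpotent :: "('k, 'r) kalg \<Rightarrow> bool" where
  "locally_nilpotent R \<longleftrightarrow>
     (\<forall>F. finite F \<and> F \<subseteq> carr R \<longrightarrow> nilpotent_set R (subring_gen R F))"

fun fsum :: "('k, 'r) kalg \<Rightarrow> (nat \<Rightarrow> 'r) \<Rightarrow> nat \<Rightarrow> 'r" where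
  "fsum R f 0 = zr R"
| "fsum R f (Suc n) = pls R (fsum R f n) (f n)"

definition nsm :: "('k, 'r) kalg \<Rightarrow> nat \<Rightarrow> 'r \<Rightarrow> 'r" where
  "nsm R m a = (pls R a ^^ m) (zr R)"

text \<open>The differential polynomial ring \<open>R[X;D]\<close>: an element \<open>\<Sum> p i X^i\<close> is represented by its
  finitely supported coefficient sequence \<open>p\<close> with coefficients in \<open>R\<close>.\<close>

definition ore_carrier :: "('k, 'r) kalg \<Rightarrow> (nat \<Rightarrow> 'r) set" where
  "ore_carrier R = {p. (\<forall>i. p i \<in> carr R) \<and> finite {i. p i \<noteq> zr R}}"

definition ore_zero :: "('k, 'r) kalg \<Rightarrow> nat \<Rightarrow> 'r" where
  "ore_zero R = (\<lambda>i. zr R)"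

definition ore_add :: "('k, 'r) kalg \<Rightarrow> (nat \<Rightarrow> 'r) \<Rightarrow> (nat \<Rightarrow> 'r) \<Rightarrow> nat \<Rightarrow> 'r" where
  "ore_add R p q = (\<lambda>i. pls R (p i) (q i))"

definition supp_bound :: "('k, 'r) kalg \<Rightarrow> (nat \<Rightarrow> 'r) \<Rightarrow> nat" where
  "supp_bound R p = (LEAST N. \<forall>i\<ge>N. p i = zr R)"

text \<open>Multiplication determined by \<open>X^i X^j = X^(i+j)\<close> and \<open>X a = a X + D a\<close>, i.e.
  \<open>(a X^i)(b X^j) = \<Sum>k\<le>i. (i choose k) a D^k(b) X^(i-k+j)\<close>.
  The coefficient of \<open>X^n\<close> collects the terms with \<open>k = i + j - n\<close>, \<open>j \<le> n \<le> i + j\<close>.\<close>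

definition ore_mul :: "('k, 'r) kalg \<Rightarrow> ('r \<Rightarrow> 'r) \<Rightarrow> (nat \<Rightarrow> 'r) \<Rightarrow> (nat \<Rightarrow> 'r) \<Rightarrow> nat \<Rightarrow> 'r" where
  "ore_mul R D p q = (\<lambda>n.
     fsum R (\<lambda>i. fsum R (\<lambda>j.
        if n \<le> i + j
        then nsm R (i choose (i + j - n)) (tms R (p i) ((D ^^ (i + j - n)) (q j)))
        else zr R) (Suc n)) (supp_bound R p))"

text \<open>Jacobson radical of the (non-unital) ring \<open>R[X;D]\<close>: the union of all right ideals
  consisting of right quasi-regular elements (with \<open>a \<circ> b = a + b - a b\<close>).\<close>

definition ore_rqr :: "('k, 'r) kalg \<Rightarrow> ('r \<Rightarrow> 'r) \<Rightarrow> (nat \<Rightarrow> 'r) \<Rightarrow> bool" where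
  "ore_rqr R D a \<longleftrightarrow> (\<exists>b\<in>ore_carrier R. ore_add R a b = ore_mul R D a b)"

definition ore_right_ideal :: "('k, 'r) kalg \<Rightarrow> ('r \<Rightarrow> 'r) \<Rightarrow> (nat \<Rightarrow> 'r) set \<Rightarrow> bool" where
  "ore_right_ideal R D I \<longleftrightarrow>
     I \<subseteq> ore_carrier R \<and> ore_zero R \<in> I \<and>
     (\<forall>a\<in>I. \<forall>b\<in>I. ore_add R a b \<in> I) \<and>
     (\<forall>a\<in>I. \<forall>b\<in>ore_carrier R. ore_add R a b = ore_zero R \<longrightarrow> b \<in> I) \<and>
     (\<forall>a\<in>I. \<forall>r\<in>ore_carrier R. ore_mul R D a r \<in> I)"

definition ore_jacobson :: "('k, 'r) kalg \<Rightarrow> ('r \<Rightarrow> 'r) \<Rightarrow> (nat \<Rightarrow> 'r) set" where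
  "ore_jacobson R D = \<Union> {I. ore_right_ideal R D I \<and> (\<forall>a\<in>I. ore_rqr R D a)}"

end

theory Submission
  imports Defs "HOL-Library.Countable"
begin

text \<open>
  We construct linear operators \<open>x\<close> and \<open>X\<close> on one space and take \<open>R\<close> to be the algebra generated by
  the iterated commutators \<open>x\<^sub>i = ad(X)^i(x)\<close>, with \<open>D = ad(X)\<close>; then \<open>R[X;D]\<close> acts on that space.

  The operators come from an infinite tower \<open>x\<^bsub>(0)\<^esub>, x\<^bsub>(1)\<^esub>, \<dots>\<close>. Given operators \<open>x', X'\<close> on \<open>W\<close>, the
  operators one level below act on \<open>W \<otimes> K[z]\<close> times a block of \<open>q\<close> positions: \<open>X = X' + z\<close>, while \<open>x\<close>
  advances the position and, when leaving the block, applies \<open>x'\<close> and projects \<open>z^(q-1)\<close> to \<open>1\<close>.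
  Inside a block \<open>x\<close> commutes with \<open>X\<close>, so \<open>x\<^sub>i\<close> with \<open>i > 0\<close> acts only when a block is left, and
  there it raises the degree in \<open>z\<close> by at most \<open>i\<close>. If \<open>q - 1 > 2 n\<close>, then no product of
  \<open>x\<^sub>0, \<dots>, x\<^sub>n\<close> can enter a block and leave it again. As \<open>q\<close> grows along the tower, this happens for every
  \<open>n\<close> at some level, and \<open>R\<close> is locally nilpotent. On the other hand \<open>(x X)^q\<close> acts as \<open>q x' X'\<close>
  on the vectors at the start of a block (the coefficient of \<open>z^(q-1)\<close> in \<open>(X' + z)^q\<close> is \<open>q X'\<close>), so
  \<open>x X\<close> is not nilpotent if each \<open>q\<close> is nonzero in \<open>K\<close>; since the position grades the action, it is not
  quasi-regular either.
\<close>

section \<open>Row-finite operators\<close>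

text \<open>Vectors are arbitrary functions on the states. Row-finiteness makes an operator
  determined by its matrix, so that the ring of operators fits into the carrier type
  \<open>'k list set\<close>.\<close>

definition row_finite :: "(('s \<Rightarrow> 'k::field) \<Rightarrow> 's \<Rightarrow> 'k) \<Rightarrow> bool" where
  "row_finite T \<longleftrightarrow>
     (\<forall>f g. T (\<lambda>s. f s + g s) = (\<lambda>s. T f s + T g s)) \<and>
     (\<forall>c f. T (\<lambda>s. c * f s) = (\<lambda>s. c * T f s)) \<and>
     (\<forall>s. \<exists>A. finite A \<and> (\<forall>f g. (\<forall>t\<in>A. f t = g t) \<longrightarrow> T f s = T g s))"

lemma row_finiteI:
  assumes "\<And>f g s. T (\<lambda>s. f s + g s) s = T f s + T g s"
    and "\<And>c f s. T (\<lambda>s. c * f s) s = c * T f s"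
    and "\<And>s. \<exists>A. finite A \<and> (\<forall>f g. (\<forall>t\<in>A. f t = g t) \<longrightarrow> T f s = T g s)"
  shows "row_finite T"
  using assms unfolding row_finite_def by (auto simp: fun_eq_iff)

lemma row_finite_local:
  assumes "row_finite T"
  obtains A where "finite A" "\<And>f g. (\<And>t. t \<in> A \<Longrightarrow> f t = g t) \<Longrightarrow> T f s = T g s"
  using assms unfolding row_finite_def by metis

lemma row_finite_comp:
  assumes T: "row_finite T" and U: "row_finite U"
  shows "row_finite (\<lambda>f. T (U f))"
proof (rule row_finiteI)
  show "\<exists>A. finite A \<and> (\<forall>f g. (\<forall>t\<in>A. f t = g t) \<longrightarrow> T (U f) s = T (U g) s)" for s
  proof -
    obtain A where A: "finite A" "\<And>f g. (\<And>t. t \<in> A \<Longrightarrow> f t = g t) \<Longrightarrow> T f s = T g s"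
      using row_finite_local[OF T] by blast
    have "\<forall>t. \<exists>B. finite B \<and> (\<forall>f g. (\<forall>u\<in>B. f u = g u) \<longrightarrow> U f t = U g t)"
      using U by (auto simp: row_finite_def)
    then obtain B where B: "\<And>t. finite (B t)"
        "\<And>t f g. (\<forall>u\<in>B t. f u = g u) \<Longrightarrow> U f t = U g t"
      by metis
    show ?thesis
      by (rule exI[of _ "\<Union>(B ` A)"]) (auto simp: A(1) B(1) intro!: A(2) B(2))
  qed
qed (use T U in \<open>simp_all add: row_finite_def\<close>)

lemma row_finite_add:
  assumes T: "row_finite T" and U: "row_finite U"
  shows "row_finite (\<lambda>f s. T f s + U f s)"
proof (rule row_finiteI)
  show "\<exists>A. finite A \<and> (\<forall>f g. (\<forall>t\<in>A. f t = g t) \<longrightarrow> T f s + U f s = T g s + U g s)" for s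
  proof -
    obtain A where A: "finite A" "\<And>f g. (\<And>t. t \<in> A \<Longrightarrow> f t = g t) \<Longrightarrow> T f s = T g s"
      using row_finite_local[OF T] by blast
    obtain B where B: "finite B" "\<And>f g. (\<And>t. t \<in> B \<Longrightarrow> f t = g t) \<Longrightarrow> U f s = U g s"
      using row_finite_local[OF U] by blast
    show ?thesis
      by (rule exI[of _ "A \<union> B"]) (auto simp: A(1) B(1) intro!: arg_cong2[where f="(+)"] A(2) B(2))
  qed
qed (use T U in \<open>simp_all add: row_finite_def algebra_simps\<close>)

lemma row_finite_scale: "row_finite (\<lambda>f s. c * f s)"
  by (rule row_finiteI) (auto simp: algebra_simps intro: exI[of _ "{_}"])

typedef (overloaded) ('s, 'k::field) rf_op =
  "{T :: ('s \<Rightarrow> 'k) \<Rightarrow> 's \<Rightarrow> 'k. row_finite T}" morphisms app Abs_op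
  using row_finite_scale by auto

setup_lifting type_definition_rf_op

lift_definition scalar :: "'k::field \<Rightarrow> ('s, 'k) rf_op" is "\<lambda>c f s. c * f s"
  by (rule row_finite_scale)

instantiation rf_op :: (type, field) ring_1
begin

lift_definition zero_rf_op :: "('a, 'b) rf_op" is "\<lambda>f s. 0"
  using row_finite_scale[of 0] by simp
lift_definition one_rf_op :: "('a, 'b) rf_op" is "\<lambda>f. f"
  using row_finite_scale[of 1] by simp
lift_definition plus_rf_op :: "('a, 'b) rf_op \<Rightarrow> ('a, 'b) rf_op \<Rightarrow> ('a, 'b) rf_op"
  is "\<lambda>T U f s. T f s + U f s"
  by (rule row_finite_add)
lift_definition uminus_rf_op :: "('a, 'b) rf_op \<Rightarrow> ('a, 'b) rf_op" is "\<lambda>T f s. - T f s"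
  using row_finite_comp[OF row_finite_scale[of "-1"]] by simp
lift_definition times_rf_op :: "('a, 'b) rf_op \<Rightarrow> ('a, 'b) rf_op \<Rightarrow> ('a, 'b) rf_op"
  is "\<lambda>T U f. T (U f)"
  by (rule row_finite_comp)
definition minus_rf_op :: "('a, 'b) rf_op \<Rightarrow> ('a, 'b) rf_op \<Rightarrow> ('a, 'b) rf_op" where
  "minus_rf_op T U = T + - U"

instance
proof
  show "(0 :: ('a, 'b) rf_op) \<noteq> 1"
    by transfer (auto simp: fun_eq_iff intro!: exI[of _ "\<lambda>_. 1"])
qed (rule minus_rf_op_def | (transfer, simp add: row_finite_def algebra_simps))+

end

lemma app_add: "app T (\<lambda>s. f s + g s) = (\<lambda>s. app T f s + app T g s)"
  using app[of T] by (simp add: row_finite_def)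

lemma app_scale: "app T (\<lambda>s. c * f s) = (\<lambda>s. c * app T f s)"
  using app[of T] by (simp add: row_finite_def)

lemma app_zero [simp]: "app T (\<lambda>s. 0) = (\<lambda>s. 0)"
  using app_scale[of T 0 "\<lambda>s. 0"] by simp

lemma app_local:
  obtains A where "finite A" "\<And>f g. (\<And>t. t \<in> A \<Longrightarrow> f t = g t) \<Longrightarrow> app T f s = app T g s"
  using row_finite_local[of "app T"] app[of T] by blast

lemma app_ring_simps [simp]:
  "app 0 f = (\<lambda>s. 0)" "app 1 f = f" "app (T + U) f = (\<lambda>s. app T f s + app U f s)"
  "app (- T) f = (\<lambda>s. - app T f s)" "app (T - U) f = (\<lambda>s. app T f s - app U f s)"
  "app (T * U) f = app T (app U f)" "app (scalar c) f = (\<lambda>s. c * f s)"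
  unfolding minus_rf_op_def by (transfer; simp)+

lemma op_eqI: "(\<And>f s. app T f s = app U f s) \<Longrightarrow> T = U"
  by (metis app_inject ext)

lemma scalar_commute: "scalar c * T = T * scalar c"
  by (rule op_eqI) (simp add: app_scale)

section \<open>Matrix entries, and coding operators in \<open>'k list set\<close>\<close>

definition entries :: "('s, 'k::field) rf_op \<Rightarrow> 's \<Rightarrow> 's \<Rightarrow> 'k" where
  "entries T t s = app T (\<lambda>u. if u = t then 1 else 0) s"

lemma app_finite_sum:
  assumes "finite A"
  shows "app T (\<lambda>u. if u \<in> A then f u else 0) s = (\<Sum>t\<in>A. f t * entries T t s)"
  using assms
proof (induction A)
  case (insert t A)
  have "(\<lambda>u. if u \<in> insert t A then f u else 0)
      = (\<lambda>u. f t * (if u = t then 1 else 0) + (if u \<in> A then f u else 0))"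
    using insert by auto
  then have "app T (\<lambda>u. if u \<in> insert t A then f u else 0) s
      = f t * entries T t s + app T (\<lambda>u. if u \<in> A then f u else 0) s"
    by (simp only: app_add app_scale entries_def)
  then show ?case using insert by simp
qed simp

text \<open>Locality lets any input be cut down to a finite support, where both operators are given
  by their entries.\<close>

lemma inj_entries: "inj entries"
proof (rule injI, rule op_eqI)
  fix T U :: "('s, 'k::field) rf_op" and f :: "'s \<Rightarrow> 'k" and s
  assume eq: "entries T = entries U"
  obtain A where A: "finite A" "\<And>f g. (\<And>t. t \<in> A \<Longrightarrow> f t = g t) \<Longrightarrow> app T f s = app T g s"
    using app_local[of T s] by blast
  obtain B where B: "finite B" "\<And>f g. (\<And>t. t \<in> B \<Longrightarrow> f t = g t) \<Longrightarrow> app U f s = app U g s"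
    using app_local[of U s] by blast
  let ?f = "\<lambda>u. if u \<in> A \<union> B then f u else 0"
  have "app T f s = app T ?f s" by (rule A(2)) auto
  also have "\<dots> = app U ?f s" using A(1) B(1) by (simp only: app_finite_sum finite_UnI eq)
  also have "\<dots> = app U f s" by (rule B(2)) auto
  finally show "app T f s = app U f s" .
qed

text \<open>A sequence is coded by its finite prefixes, each recognised by its length.\<close>

lemma inj_prefixes: "inj (\<lambda>f :: nat \<Rightarrow> 'a. {map f [0..<n] | n. True})"
proof (rule injI, rule ext)
  fix f g :: "nat \<Rightarrow> 'a" and i
  assume "{map f [0..<n] | n. True} = {map g [0..<n] | n. True}"
  then have "map f [0..<Suc i] \<in> {map g [0..<n] | n. True}" by blast
  then obtain n where n: "map f [0..<Suc i] = map g [0..<n]" by blast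
  then have "n = Suc i" by (metis diff_zero length_map length_upt)
  with n show "f i = g i" by simp
qed

lemma ex_inj_rf_op: "\<exists>h :: ('s::countable, 'k::field) rf_op \<Rightarrow> 'k list set. inj h"
proof -
  let ?seq = "\<lambda>(M :: 's \<Rightarrow> 's \<Rightarrow> 'k) n. case from_nat n of (t, s) \<Rightarrow> M t s"
  have "inj ?seq"
  proof (rule injI, intro ext)
    fix M N :: "'s \<Rightarrow> 's \<Rightarrow> 'k" and t s
    assume "?seq M = ?seq N"
    from fun_cong[OF this, of "to_nat (t :: 's, s :: 's)"] show "M t s = N t s" by simp
  qed
  then have "inj ((\<lambda>f. {map f [0..<n] | n. True}) \<circ> (?seq \<circ> entries))"
    by (intro inj_compose inj_entries inj_prefixes)
  then show ?thesis by blast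
qed

section \<open>The tower of operators\<close>

text \<open>A state lists, for each level starting from the lowest, the position within the current block
  and the exponent of \<open>z\<close>; all levels beyond the end of the list act as \<open>0\<close>.\<close>

type_synonym state = "(nat \<times> nat) list"

abbreviation (input) slice :: "(state \<Rightarrow> 'k) \<Rightarrow> nat \<Rightarrow> nat \<Rightarrow> state \<Rightarrow> 'k" where
  "slice f p e \<equiv> \<lambda>s. f ((p, e) # s)"

text \<open>\<open>f\<close> lists coefficients, so multiplication by \<open>z\<close> reads the
  exponent \<open>e - 1\<close>; over the whole list this is the sum of the multiplications by
  \<open>z\<close> at all levels.\<close>

fun X_fun :: "(state \<Rightarrow> 'k::field) \<Rightarrow> state \<Rightarrow> 'k" where
  "X_fun f [] = 0"
| "X_fun f ((p, e) # s) = X_fun (slice f p e) s + (if e = 0 then 0 else f ((p, e - 1) # s))"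

text \<open>In coefficient form the arrows reverse: position \<open>p\<close> reads
  \<open>p - 1\<close>. Position 0 with exponent 0 reads the coefficient of
  \<open>z^(q k - 1)\<close> at the last position \<open>q k - 1\<close>, through the operator of
  the next level.\<close>

fun x_fun :: "(nat \<Rightarrow> nat) \<Rightarrow> nat \<Rightarrow> (state \<Rightarrow> 'k::field) \<Rightarrow> state \<Rightarrow> 'k" where
  "x_fun q k f [] = 0"
| "x_fun q k f ((p, e) # s) =
     (if p = 0 then if e = 0 then x_fun q (Suc k) (slice f (q k - 1) (q k - 1)) s else 0
      else if p < q k then f ((p - 1, e) # s) else 0)"

lemma row_finite_X_fun: "row_finite X_fun"
proof (rule row_finiteI)
  show "X_fun (\<lambda>s. f s + g s) s = X_fun f s + X_fun g s" for f g :: "state \<Rightarrow> 'a" and s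
    by (induction s arbitrary: f g) (auto simp: algebra_simps)
  show "X_fun (\<lambda>s. c * f s) s = c * X_fun f s" for c and f :: "state \<Rightarrow> 'a" and s
    by (induction f s rule: X_fun.induct) (auto simp: algebra_simps)
  show "\<exists>A. finite A \<and> (\<forall>f g :: state \<Rightarrow> 'a. (\<forall>t\<in>A. f t = g t) \<longrightarrow> X_fun f s = X_fun g s)" for s
  proof (induction s)
    case (Cons h s)
    then obtain A where A: "finite A"
        "\<And>f g :: state \<Rightarrow> 'a. (\<forall>t\<in>A. f t = g t) \<Longrightarrow> X_fun f s = X_fun g s"
      by blast
    obtain p e where h: "h = (p, e)" by fastforce
    have "X_fun f (h # s) = X_fun g (h # s)"
      if "\<forall>t\<in>insert ((p, e - 1) # s) (Cons h ` A). f t = g t" for f g :: "state \<Rightarrow> 'a"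
      using A(2)[of "slice f p e" "slice g p e"] that by (auto simp: h)
    then show ?case using A(1) by (intro exI[of _ "insert ((p, e - 1) # s) (Cons h ` A)"]) auto
  qed auto
qed

lemma row_finite_x_fun: "row_finite (x_fun q k)"
proof (rule row_finiteI)
  show "x_fun q k (\<lambda>s. f s + g s) s = x_fun q k f s + x_fun q k g s" for f g :: "state \<Rightarrow> 'a" and s
    by (induction q k f s arbitrary: g rule: x_fun.induct) auto
  show "x_fun q k (\<lambda>s. c * f s) s = c * x_fun q k f s" for c and f :: "state \<Rightarrow> 'a" and s
    by (induction q k f s rule: x_fun.induct) auto
  show "\<exists>A. finite A \<and> (\<forall>f g :: state \<Rightarrow> 'a. (\<forall>t\<in>A. f t = g t) \<longrightarrow> x_fun q k f s = x_fun q k g s)" for s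
  proof (induction s arbitrary: k)
    case (Cons h s)
    then obtain A where A: "finite A"
        "\<And>f g :: state \<Rightarrow> 'a. (\<forall>t\<in>A. f t = g t) \<Longrightarrow> x_fun q (Suc k) f s = x_fun q (Suc k) g s"
      by blast
    obtain p e where h: "h = (p, e)" by fastforce
    let ?B = "insert ((p - 1, e) # s) (Cons (q k - 1, q k - 1) ` A)"
    have "x_fun q k f (h # s) = x_fun q k g (h # s)" if "\<forall>t\<in>?B. f t = g t" for f g :: "state \<Rightarrow> 'a"
      using A(2)[of "slice f (q k - 1) (q k - 1)" "slice g (q k - 1) (q k - 1)"] that
      by (auto simp: h)
    then show ?case using A(1) by (intro exI[of _ ?B]) auto
  qed auto
qed

lift_definition X_op :: "(state, 'k::field) rf_op" is X_fun
  by (rule row_finite_X_fun)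

lift_definition x_op :: "(nat \<Rightarrow> nat) \<Rightarrow> nat \<Rightarrow> (state, 'k::field) rf_op" is x_fun
  by (rule row_finite_x_fun)

section \<open>Iterated commutators and their action on blocks\<close>

definition ad :: "'a::ring \<Rightarrow> 'a \<Rightarrow> 'a" where
  "ad X T = X * T - T * X"

definition gen :: "(nat \<Rightarrow> nat) \<Rightarrow> nat \<Rightarrow> nat \<Rightarrow> (state, 'k::field) rf_op" where
  "gen q k i = (ad X_op ^^ i) (x_op q k)"

lemma gen_0: "gen q k 0 = x_op q k"
  and gen_Suc: "gen q k (Suc i) = X_op * gen q k i - gen q k i * X_op"
  by (simp_all add: gen_def ad_def)

lemma app_X_Nil [simp]: "app X_op f [] = 0"
  by (simp add: X_op.rep_eq)

lemma app_gen_Nil [simp]: "app (gen q k i) f [] = 0"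
  by (induction i arbitrary: f) (simp_all add: gen_0 gen_Suc x_op.rep_eq)

lemma slice_X:
  "slice (app X_op f) p e =
     (\<lambda>s. app X_op (slice f p e) s + (if e = 0 then 0 else f ((p, e - 1) # s)))"
  by (auto simp: X_op.rep_eq)

lemma slice_x:
  "slice (app (x_op q k) f) p e =
     (if p = 0 then if e = 0 then app (x_op q (Suc k)) (slice f (q k - 1) (q k - 1)) else (\<lambda>s. 0)
      else if p < q k then slice f (p - 1) e else (\<lambda>s. 0))"
  by (auto simp: x_op.rep_eq)

text \<open>\<open>X_op\<close> acts alike at all positions, so it commutes with the move from
  \<open>p - 1\<close> to \<open>p\<close>.\<close>

lemma slice_gen_interior:
  assumes "p \<noteq> 0"
  shows "slice (app (gen q k i) f) p e = (if i = 0 \<and> p < q k then slice f (p - 1) e else (\<lambda>s. 0))"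
proof (induction i arbitrary: f e)
  case 0
  show ?case using assms by (simp add: gen_0 slice_x)
next
  case (Suc i)
  have "slice (app (gen q k (Suc i)) f) p e
      = (\<lambda>s. slice (app X_op (app (gen q k i) f)) p e s - slice (app (gen q k i) (app X_op f)) p e s)"
    by (simp add: gen_Suc)
  also have "\<dots> = (\<lambda>s. 0)"
  proof
    fix s
    have "app (gen q k i) g ((p, e') # s) = (if i = 0 \<and> p < q k then g ((p - 1, e') # s) else 0)"
      for g :: "state \<Rightarrow> 'a" and e'
      using fun_cong[OF Suc.IH[of g e'], of s] by auto
    then show "slice (app X_op (app (gen q k i) f)) p e s - slice (app (gen q k i) (app X_op f)) p e s
        = 0"
      unfolding fun_cong[OF slice_X] Suc.IH by (auto simp: fun_cong[OF slice_X])
  qed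
  finally show ?case by simp
qed

text \<open>\<open>crossing_coeff i e b\<close> is the coefficient of \<open>z^e \<pi> z^b \<otimes> ad(X')^(i-e-b)(x')\<close> in
  \<open>ad(X' + z)^i (\<pi> \<otimes> x')\<close>, where \<open>\<pi>\<close> projects \<open>z^(q-1)\<close> to \<open>1\<close>.\<close>

fun crossing_coeff :: "nat \<Rightarrow> nat \<Rightarrow> nat \<Rightarrow> 'k::field" where
  "crossing_coeff 0 e b = (if e = 0 \<and> b = 0 then 1 else 0)"
| "crossing_coeff (Suc i) e b = crossing_coeff i e b
     + (if e = 0 then 0 else crossing_coeff i (e - 1) b)
     - (if b = 0 then 0 else crossing_coeff i e (b - 1))"

lemma crossing_coeff_eq_0: "e + b > i \<Longrightarrow> crossing_coeff i e b = 0"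
  by (induction i e b rule: crossing_coeff.induct) auto

text \<open>This is \<open>\<pi> z^b\<close> applied at the last position \<open>r\<close>: the
  coefficient of \<open>z^r\<close> in \<open>z^b f\<close>.\<close>

definition exit_slice :: "nat \<Rightarrow> (state \<Rightarrow> 'k::field) \<Rightarrow> nat \<Rightarrow> state \<Rightarrow> 'k" where
  "exit_slice r f b = (if b \<le> r then slice f r (r - b) else (\<lambda>s. 0))"

lemma exit_slice_X:
  "exit_slice r (app X_op f) b = (\<lambda>s. app X_op (exit_slice r f b) s + exit_slice r f (Suc b) s)"
  by (auto simp: exit_slice_def slice_X fun_cong[OF slice_X])

text \<open>\<open>ad (X' + z)\<close> is \<open>ad X'\<close> plus left minus right multiplication
  by \<open>z\<close>; the recursion of \<open>crossing_coeff\<close> counts the choices among the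
  three. Truncation in \<open>i - e - b\<close> is harmless, since the coefficient is 0 for
  \<open>e + b > i\<close>.\<close>

lemma slice_gen_crossing:
  "slice (app (gen q k i) f) 0 e =
     (\<lambda>s. \<Sum>b\<le>i. crossing_coeff i e b * app (gen q (Suc k) (i - e - b)) (exit_slice (q k - 1) f b) s)"
proof (induction i arbitrary: f e)
  case 0
  show ?case by (auto simp: gen_0 slice_x exit_slice_def)
next
  case (Suc i)
  define r where "r = q k - 1"
  let ?c = "\<lambda>i e b. crossing_coeff i e b :: 'a"
  let ?g = "\<lambda>b s. app (gen q (Suc k) (Suc i - e - b)) (exit_slice r f b) s"
  have lin: "app T (\<lambda>s. \<Sum>b\<le>i. (d b :: 'a) * h b s) = (\<lambda>s. \<Sum>b\<le>i. d b * app T (h b) s)"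
    for T :: "(state, 'a) rf_op" and d h and i :: nat
    by (induction i) (simp_all add: app_add app_scale)
  show ?case
  proof
    fix s
    have "slice (app (gen q k (Suc i)) f) 0 e s
      = slice (app X_op (app (gen q k i) f)) 0 e s - slice (app (gen q k i) (app X_op f)) 0 e s"
      by (simp add: gen_Suc)
    also have "slice (app X_op (app (gen q k i) f)) 0 e s
      = (\<Sum>b\<le>i. ?c i e b * app X_op (app (gen q (Suc k) (i - e - b)) (exit_slice r f b)) s)
        + (if e = 0 then 0 else slice (app (gen q k i) f) 0 (e - 1) s)"
      unfolding fun_cong[OF slice_X] Suc.IH r_def lin by simp
    also have "slice (app (gen q k i) f) 0 (e - 1) s
      = (\<Sum>b\<le>i. ?c i (e - 1) b * app (gen q (Suc k) (i - (e - 1) - b)) (exit_slice r f b) s)"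
      unfolding r_def by (rule fun_cong[OF Suc.IH])
    also have "slice (app (gen q k i) (app X_op f)) 0 e s
      = (\<Sum>b\<le>i. ?c i e b * (app (gen q (Suc k) (i - e - b)) (app X_op (exit_slice r f b)) s
          + app (gen q (Suc k) (i - e - b)) (exit_slice r f (Suc b)) s))"
      using fun_cong[OF Suc.IH[of "app X_op f" e], of s] by (simp only: exit_slice_X app_add r_def)
    finally have eq: "slice (app (gen q k (Suc i)) f) 0 e s =
      (\<Sum>b\<le>i. ?c i e b * app X_op (app (gen q (Suc k) (i - e - b)) (exit_slice r f b)) s)
      + (if e = 0 then 0 else
          \<Sum>b\<le>i. ?c i (e - 1) b * app (gen q (Suc k) (i - (e - 1) - b)) (exit_slice r f b) s)
      - (\<Sum>b\<le>i. ?c i e b * (app (gen q (Suc k) (i - e - b)) (app X_op (exit_slice r f b)) s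
          + app (gen q (Suc k) (i - e - b)) (exit_slice r f (Suc b)) s))" .
    \<comment> \<open>The contributions of \<open>ad X'\<close>, of left and of right multiplication
      by \<open>z\<close> are brought to one range and the same vectors \<open>?g b\<close>, ready
      for the recursion in 4.\<close>
    have 1: "(\<Sum>b\<le>i. ?c i e b * app X_op (app (gen q (Suc k) (i - e - b)) (exit_slice r f b)) s)
        - (\<Sum>b\<le>i. ?c i e b * app (gen q (Suc k) (i - e - b)) (app X_op (exit_slice r f b)) s)
        = (\<Sum>b\<le>Suc i. ?c i e b * ?g b s)"
    proof -
      have "?c i e b * app X_op (app (gen q (Suc k) (i - e - b)) (exit_slice r f b)) s
        - ?c i e b * app (gen q (Suc k) (i - e - b)) (app X_op (exit_slice r f b)) s
        = ?c i e b * ?g b s" for b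
      proof (cases "e + b \<le> i")
        case True
        then have "Suc i - e - b = Suc (i - e - b)" by simp
        then show ?thesis by (simp add: gen_Suc right_diff_distrib)
      qed (simp add: crossing_coeff_eq_0)
      then show ?thesis by (simp add: sum_subtractf[symmetric] crossing_coeff_eq_0)
    qed
    have 2: "(\<Sum>b\<le>i. ?c i (e - 1) b * app (gen q (Suc k) (i - (e - 1) - b)) (exit_slice r f b) s)
        = (\<Sum>b\<le>Suc i. ?c i (e - 1) b * ?g b s)" if "e \<noteq> 0"
      using that by (cases e) (simp_all add: crossing_coeff_eq_0)
    have 3: "(\<Sum>b\<le>i. ?c i e b * app (gen q (Suc k) (i - e - b)) (exit_slice r f (Suc b)) s)
        = (\<Sum>b\<le>Suc i. (if b = 0 then 0 else ?c i e (b - 1)) * ?g b s)"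
    proof -
      have "Suc i - e - Suc b = i - e - b" for b by arith
      then show ?thesis by (subst sum.atMost_Suc_shift) simp
    qed
    have 4: "(\<Sum>b\<le>Suc i. ?c (Suc i) e b * ?g b s) = (\<Sum>b\<le>Suc i. ?c i e b * ?g b s)
        + (if e = 0 then 0 else \<Sum>b\<le>Suc i. ?c i (e - 1) b * ?g b s)
        - (\<Sum>b\<le>Suc i. (if b = 0 then 0 else ?c i e (b - 1)) * ?g b s)"
      by (simp only: crossing_coeff.simps ring_distribs sum.distrib sum_subtractf) simp
    have "slice (app (gen q k (Suc i)) f) 0 e s = (\<Sum>b\<le>Suc i. ?c (Suc i) e b * ?g b s)"
      unfolding eq 4 1[symmetric] 3[symmetric] using 2
      by (simp only: ring_distribs sum.distrib) simp
    then show "slice (app (gen q k (Suc i)) f) 0 e s = (\<Sum>b\<le>Suc i. ?c (Suc i) e b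
        * app (gen q (Suc k) (Suc i - e - b)) (exit_slice (q k - 1) f b) s)"
      by (simp only: r_def)
  qed
qed

section \<open>Local nilpotency\<close>

text \<open>Here \<open>t\<close> bounds the number of factors that kill every vector; the linear
  closure carries the drop from the generators to the whole algebra.\<close>

definition nil_filtration ::
    "(nat \<Rightarrow> nat) \<Rightarrow> nat \<Rightarrow> nat \<Rightarrow> nat \<Rightarrow> (nat \<Rightarrow> (state \<Rightarrow> 'k::field) set) \<Rightarrow> bool" where
  "nil_filtration q k n t F \<longleftrightarrow>
     F 0 = UNIV \<and> F t \<subseteq> {\<lambda>s. 0} \<and>
     (\<forall>j. F (Suc j) \<subseteq> F j \<and> (\<lambda>s. 0) \<in> F j \<and>
       (\<forall>f\<in>F j. \<forall>g\<in>F j. (\<lambda>s. f s + g s) \<in> F j) \<and>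
       (\<forall>c. \<forall>f\<in>F j. (\<lambda>s. c * f s) \<in> F j) \<and>
       (\<forall>i\<le>n. \<forall>f\<in>F j. app (gen q k i) f \<in> F (Suc j)))"

lemma nil_filtrationD:
  assumes "nil_filtration q k n t F"
  shows "F 0 = UNIV" "f \<in> F t \<Longrightarrow> f = (\<lambda>s. 0)" "f \<in> F (Suc j) \<Longrightarrow> f \<in> F j" "(\<lambda>s. 0) \<in> F j"
    "f \<in> F j \<Longrightarrow> g \<in> F j \<Longrightarrow> (\<lambda>s. f s + g s) \<in> F j"
    "f \<in> F j \<Longrightarrow> (\<lambda>s. c * f s) \<in> F j"
    "i \<le> n \<Longrightarrow> f \<in> F j \<Longrightarrow> app (gen q k i) f \<in> F (Suc j)"
  using assms unfolding nil_filtration_def by blast+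

lemma nil_filtration_antimono:
  assumes "nil_filtration q k n t F" "i \<le> j" "f \<in> F j"
  shows "f \<in> F i"
  using assms(2,3) by (induction rule: dec_induct) (auto dest: nil_filtrationD(3)[OF assms(1)])

lemma nil_filtration_sum:
  assumes "nil_filtration q k n t F" "\<And>b. b \<le> (i::nat) \<Longrightarrow> h b \<in> F j"
  shows "(\<lambda>s. \<Sum>b\<le>i. c b * h b s) \<in> F j"
  using assms(2)
  by (induction i) (auto intro!: nil_filtrationD(5,6)[OF assms(1)])

lemma nil_filtration_base:
  assumes q: "2 * n + 1 < q k"
  shows "\<exists>t (F :: nat \<Rightarrow> (state \<Rightarrow> 'k::field) set). nil_filtration q k n t F"
proof -
  \<comment> \<open>After \<open>m\<close> steps the positions \<open>p < m\<close> have been reached through an entry, so \<open>e \<le> n\<close> there; leaving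
    the block from such a state needs \<open>e + n \<ge> q k - 1\<close>, so the second round contributes nothing.\<close>
  define Z where "Z m p e \<longleftrightarrow> (0 < m \<and> q k \<le> p) \<or> (p < m \<and> n < e) \<or> (p + q k < m)" for m p e
  define F where "F m = {f :: state \<Rightarrow> 'k. (0 < m \<longrightarrow> f [] = 0) \<and>
      (\<forall>p e s. Z m p e \<longrightarrow> f ((p, e) # s) = 0)}" for m
  have "app (gen q k i) f \<in> F (Suc j)" if i: "i \<le> n" and f: "f \<in> F j" for i j f
  proof -
    have "app (gen q k i) f ((p, e) # s) = 0" if Z: "Z (Suc j) p e" for p e s
    proof (cases "p = 0")
      case False
      have "p < q k \<Longrightarrow> Z j (p - 1) e" using Z False unfolding Z_def by auto
      then show ?thesis
        using fun_cong[OF slice_gen_interior[OF False, of q k i f e], of s] f by (auto simp: F_def)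
    next
      case True
      show ?thesis
      proof (cases "n < e")
        case True
        then show ?thesis using fun_cong[OF slice_gen_crossing[of q k i f e], of s] i \<open>p = 0\<close>
          by (simp add: crossing_coeff_eq_0)
      next
        case False
        then have "q k \<le> j" using Z True by (auto simp: Z_def)
        \<comment> \<open>Leaving from position \<open>q k - 1 < j\<close> reads an exponent of at
          least \<open>q k - 1 - n\<close>, which exceeds \<open>n\<close> because
          \<open>2 * n + 1 < q k\<close>.\<close>
        then have "exit_slice (q k - 1) f b = (\<lambda>s. 0)" if "b \<le> i" for b
        proof -
          have "Z j (q k - 1) (q k - 1 - b)" using \<open>q k \<le> j\<close> q i that by (auto simp: Z_def)
          then show ?thesis using f by (simp add: exit_slice_def F_def)
        qed
        then show ?thesis using fun_cong[OF slice_gen_crossing[of q k i f e], of s] \<open>p = 0\<close> by simp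
      qed
    qed
    then show ?thesis by (simp add: F_def)
  qed
  moreover have "F (2 * q k) \<subseteq> {\<lambda>s. 0}"
  proof
    fix f assume f: "f \<in> F (2 * q k)"
    have "f s = 0" for s
    proof (cases s)
      case (Cons h u)
      obtain p e where h: "h = (p, e)" by fastforce
      have "Z (2 * q k) p e" using q by (auto simp: Z_def)
      then show ?thesis using f by (simp add: F_def Cons h)
    qed (use f q in \<open>simp add: F_def\<close>)
    then show "f \<in> {\<lambda>s. 0}" by auto
  qed
  moreover have "F 0 = UNIV" by (auto simp: F_def Z_def)
  moreover have "F (Suc j) \<subseteq> F j" for j by (auto simp: F_def Z_def)
  ultimately have "nil_filtration q k n (2 * q k) F"
    unfolding nil_filtration_def by (simp add: F_def)
  then show ?thesis by blast
qed

text \<open>Level \<open>k + 1\<close> is acted on only when a block is left, once in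
  \<open>q k\<close> steps, so its filtration is stretched by the factor \<open>q k\<close>.\<close>

lemma nil_filtration_step:
  fixes F' :: "nat \<Rightarrow> (state \<Rightarrow> 'k::field) set"
  assumes q: "0 < q k" and F': "nil_filtration q (Suc k) n t F'"
  shows "\<exists>t (F :: nat \<Rightarrow> (state \<Rightarrow> 'k::field) set). nil_filtration q k n t F"
proof -
  note D = nil_filtrationD[OF F']
  \<comment> \<open>The index is the ceiling of \<open>(m - p) / q k\<close>: the number of block
    exits among \<open>m\<close> steps ending at position \<open>p\<close>.\<close>
  define F where "F m = {f :: state \<Rightarrow> 'k. (0 < m \<longrightarrow> f [] = 0) \<and>
      (\<forall>p e. (p < q k \<longrightarrow> slice f p e \<in> F' ((m + q k - 1 - p) div q k)) \<and>
        (q k \<le> p \<and> 0 < m \<longrightarrow> (\<forall>s. f ((p, e) # s) = 0)))}" for m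
  have "app (gen q k i) f \<in> F (Suc j)" if i: "i \<le> n" and f: "f \<in> F j" for i j f
  proof -
    have fD: "slice f p e \<in> F' ((j + q k - 1 - p) div q k)" if "p < q k" for p e
      using f that by (simp add: F_def)
    have "slice (app (gen q k i) f) p e \<in> F' ((Suc j + q k - 1 - p) div q k)" if p: "p < q k" for p e
    proof (cases "p = 0")
      case False
      then have "slice f (p - 1) e \<in> F' ((j + q k - 1 - (p - 1)) div q k)"
        using p by (intro fD) simp
      moreover have "j + q k - 1 - (p - 1) = Suc j + q k - 1 - p" using False p by simp
      ultimately show ?thesis
        unfolding slice_gen_interior[OF False] using p D(4) by simp
    next
      case True
      have exit: "exit_slice (q k - 1) f b \<in> F' (j div q k)" for b
      proof -
        have "slice f (q k - 1) (q k - 1 - b) \<in> F' ((j + q k - 1 - (q k - 1)) div q k)"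
          using q by (intro fD) simp
        then show ?thesis using D(4) q by (auto simp: exit_slice_def)
      qed
      have "slice (app (gen q k i) f) 0 e \<in> F' (Suc (j div q k))"
        unfolding slice_gen_crossing
        by (rule nil_filtration_sum[OF F']) (use i exit in \<open>auto intro!: D(7)\<close>)
      moreover have "(Suc j + q k - 1 - 0) div q k = Suc (j div q k)" using q by simp
      ultimately show ?thesis using True by simp
    qed
    moreover have "app (gen q k i) f ((p, e) # s) = 0" if "q k \<le> p" for p e s
      using fun_cong[OF slice_gen_interior[of p q k i f e], of s] that q by auto
    ultimately show ?thesis by (simp add: F_def)
  qed
  moreover have "F (t * q k) \<subseteq> {\<lambda>s. 0}"
  proof
    fix f assume f: "f \<in> F (t * q k)"
    have "f s = 0" for s
    proof (cases "t = 0")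
      \<comment> \<open>Here the whole space \<open>F' 0\<close> is zero; the constant function with
        value \<open>f s\<close> is used to read off \<open>f s = 0\<close>.\<close>
      case True
      then have "(\<lambda>_. f s) \<in> F' t" using D(1) by simp
      from fun_cong[OF D(2)[OF this]] show ?thesis by simp
    next
      case False
      show ?thesis
      proof (cases s)
        case (Cons h u)
        obtain p e where h: "h = (p, e)" by fastforce
        have zero: "slice f p e = (\<lambda>s. 0)" if "p < q k"
        proof (rule D(2), rule nil_filtration_antimono[OF F'])
          have "t * q k \<le> t * q k + q k - 1 - p" using that by simp
          then show "t \<le> (t * q k + q k - 1 - p) div q k"
            using q by (simp add: less_eq_div_iff_mult_less_eq)
        qed (use f that in \<open>simp add: F_def\<close>)
        show ?thesis
        proof (cases "p < q k")
          case True
          from fun_cong[OF zero[OF True], of u] show ?thesis by (simp add: Cons h)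
        next
          case p: False
          have "0 < t * q k" using False q by simp
          with f p show ?thesis unfolding F_def Cons h by simp
        qed
      qed (use f False q in \<open>auto simp: F_def\<close>)
    qed
    then show "f \<in> {\<lambda>s. 0}" by auto
  qed
  moreover have "F 0 = UNIV" using D(1) by (auto simp: F_def)
  moreover have "F (Suc j) \<subseteq> F j" for j
  proof
    fix f assume f: "f \<in> F (Suc j)"
    have "slice f p e \<in> F' ((j + q k - 1 - p) div q k)" if "p < q k" for p e
    proof (rule nil_filtration_antimono[OF F'])
      show "(j + q k - 1 - p) div q k \<le> (Suc j + q k - 1 - p) div q k"
        by (rule div_le_mono) simp
    qed (use f that in \<open>simp add: F_def\<close>)
    then show "f \<in> F j" using f by (simp add: F_def)
  qed
  moreover have "(\<lambda>s. 0) \<in> F j" for j by (simp add: F_def D(4))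
  moreover have "(\<lambda>s. f s + g s) \<in> F j" if "f \<in> F j" "g \<in> F j" for f g j
    using that by (simp add: F_def D(5))
  moreover have "(\<lambda>s. c * f s) \<in> F j" if "f \<in> F j" for c f j
    using that by (simp add: F_def D(6))
  ultimately have "nil_filtration q k n (t * q k) F"
    unfolding nil_filtration_def by simp
  then show ?thesis by blast
qed

text \<open>Level \<open>n\<close> has blocks long enough for the base case; the step lemma then
  descends to level 0.\<close>

lemma ex_nil_filtration:
  assumes q: "\<And>k. 2 * k + 2 \<le> q k"
  shows "\<exists>t (F :: nat \<Rightarrow> (state \<Rightarrow> 'k::field) set). nil_filtration q 0 n t F"
proof -
  have "\<exists>t (F :: nat \<Rightarrow> (state \<Rightarrow> 'k) set). nil_filtration q k n t F" if "k \<le> n" for k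
    using that
  proof (induction rule: inc_induct)
    case base
    show ?case using q[of n] by (intro nil_filtration_base) simp
  next
    case (step k)
    have "0 < q k" using q[of k] by simp
    then show ?case using step nil_filtration_step by blast
  qed
  then show ?thesis by simp
qed

section \<open>Grading by position\<close>

text \<open>The mixed-radix number with the positions as digits and radices \<open>q k\<close>;
  \<open>x_op\<close> counts up by one, carrying when a block is left.\<close>

fun pos :: "(nat \<Rightarrow> nat) \<Rightarrow> nat \<Rightarrow> state \<Rightarrow> nat" where
  "pos q k [] = 0"
| "pos q k ((p, e) # s) = p + q k * pos q (Suc k) s"

text \<open>\<open>T\<close> raises \<open>pos\<close> by at least \<open>l\<close> and at most
  \<open>u\<close>, expressed by which input coordinates an output coordinate may depend on.\<close>

definition shifts :: "(nat \<Rightarrow> nat) \<Rightarrow> nat \<Rightarrow> nat \<Rightarrow> (state, 'k::field) rf_op \<Rightarrow> bool" where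
  "shifts q l u T \<longleftrightarrow> (\<forall>f s.
     (\<forall>t. pos q 0 t + l \<le> pos q 0 s \<longrightarrow> pos q 0 s \<le> pos q 0 t + u \<longrightarrow> f t = 0) \<longrightarrow> app T f s = 0)"

lemma X_fun_eq_0: "(\<And>t. pos q k t = pos q k s \<Longrightarrow> f t = 0) \<Longrightarrow> X_fun f s = 0"
proof (induction s arbitrary: k f)
  case (Cons h s)
  obtain p e where h: "h = (p, e)" by fastforce
  have "X_fun (slice f p e) s = 0"
    by (rule Cons.IH[of "Suc k"]) (simp add: h Cons.prems)
  then show ?case by (simp add: h Cons.prems)
qed simp

lemma x_fun_eq_0:
  assumes "\<And>k. 0 < q k" and "\<And>t. Suc (pos q k t) = pos q k s \<Longrightarrow> f t = 0"
  shows "x_fun q k f s = 0"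
  using assms
proof (induction q k f s rule: x_fun.induct)
  case (2 q k f p e s)
  have "x_fun q (Suc k) (slice f (q k - 1) (q k - 1)) s = 0" if [simp]: "p = 0" "e = 0"
  proof (rule "2.IH")
    fix t assume t: "Suc (pos q (Suc k) t) = pos q (Suc k) s"
    have "Suc (pos q k ((q k - 1, q k - 1) # t)) = q k * Suc (pos q (Suc k) t)"
      using "2.prems"(1)[of k] by simp
    then show "f ((q k - 1, q k - 1) # t) = 0" using t by (intro "2.prems"(2)) simp
  qed (use "2.prems"(1) in auto)
  then show ?case using "2.prems"(2) by auto
qed simp

lemma shifts_X: "shifts q 0 0 X_op"
  unfolding shifts_def X_op.rep_eq by (auto intro!: X_fun_eq_0[of q 0])

lemma shifts_x: "(\<And>k. 0 < q k) \<Longrightarrow> shifts q 1 1 (x_op q 0)"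
  unfolding shifts_def x_op.rep_eq by (auto intro!: x_fun_eq_0)

lemma shifts_add:
  assumes "shifts q l u T" "shifts q l' u' U"
  shows "shifts q (min l l') (max u u') (T + U)"
  unfolding shifts_def
proof (intro allI impI)
  fix f :: "state \<Rightarrow> 'a" and s
  assume f: "\<forall>t. pos q 0 t + min l l' \<le> pos q 0 s \<longrightarrow> pos q 0 s \<le> pos q 0 t + max u u' \<longrightarrow> f t = 0"
  have "app T f s = 0" using assms(1) f unfolding shifts_def by force
  moreover have "app U f s = 0" using assms(2) f unfolding shifts_def by force
  ultimately show "app (T + U) f s = 0" by simp
qed

lemma shifts_uminus: "shifts q l u T \<Longrightarrow> shifts q l u (- T)"
  by (simp add: shifts_def)

lemma shifts_scalar: "shifts q 0 0 (scalar c)"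
  by (simp add: shifts_def)

lemma shifts_mult:
  assumes "shifts q l u T" "shifts q l' u' U"
  shows "shifts q (l + l') (u + u') (T * U)"
  unfolding shifts_def
proof (intro allI impI)
  fix f :: "state \<Rightarrow> 'a" and s
  assume f: "\<forall>t. pos q 0 t + (l + l') \<le> pos q 0 s \<longrightarrow> pos q 0 s \<le> pos q 0 t + (u + u') \<longrightarrow> f t = 0"
  have "app U f t = 0" if "pos q 0 t + l \<le> pos q 0 s" "pos q 0 s \<le> pos q 0 t + u" for t
    using assms(2) f that unfolding shifts_def by force
  then show "app (T * U) f s = 0" using assms(1) unfolding shifts_def by simp
qed

lemma shifts_power: "shifts q l u T \<Longrightarrow> shifts q (m * l) (m * u) (T ^ m)"
proof (induction m)
  case 0
  show ?case by (simp add: shifts_def)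
next
  case (Suc m)
  then show ?case using shifts_mult[of q l u T] by simp
qed

lemma shifts_gen:
  assumes "\<And>k. 0 < q k"
  shows "shifts q 1 1 (gen q 0 i)"
proof (induction i)
  case 0
  show ?case using assms by (simp only: gen_0 shifts_x)
next
  case (Suc i)
  show ?case
    using shifts_add[OF shifts_mult[OF shifts_X Suc] shifts_uminus[OF shifts_mult[OF Suc shifts_X]]]
    by (simp add: gen_Suc)
qed

section \<open>Powers of \<open>x X\<close>\<close>

definition embed :: "(state \<Rightarrow> 'k::field) \<Rightarrow> state \<Rightarrow> 'k" where
  "embed g s = (case s of [] \<Rightarrow> 0 | (p, e) # t \<Rightarrow> if p = 0 \<and> e = 0 then g t else 0)"

text \<open>As long as no block is left, \<open>x_op\<close> commutes with \<open>X_op\<close>, so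
  the power is a move by \<open>j\<close> positions times \<open>(X' + z)^j\<close>, expanded
  binomially.\<close>

lemma xX_power_embed:
  assumes "j < q k"
  shows "app ((x_op q k * X_op) ^ j) (embed g) = (\<lambda>s. case s of [] \<Rightarrow> 0 | (p, e) # t \<Rightarrow>
           if p = j then of_nat (j choose e) * app (X_op ^ (j - e)) g t else 0)"
  using assms
proof (induction j)
  case 0
  show ?case by (auto simp: embed_def fun_eq_iff binomial_eq_0 split: list.splits)
next
  case (Suc j)
  let ?h = "app ((x_op q k * X_op) ^ j) (embed g)"
  have h: "slice ?h p e
      = (if p = j then (\<lambda>t. of_nat (j choose e) * app (X_op ^ (j - e)) g t) else (\<lambda>t. 0))" for p e
    using Suc by (auto simp: fun_eq_iff)
  note h' = fun_cong[OF h]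
  have "app (x_op q k) (app X_op ?h) ((p, e) # t) =
      (if p = Suc j then of_nat (Suc j choose e) * app (X_op ^ (Suc j - e)) g t else 0)" for p e t
  proof -
    have X: "slice (app X_op ?h) p' e' t'
        = (if p' = j then of_nat (Suc j choose e') * app (X_op ^ (Suc j - e')) g t' else 0)" for p' e' t'
    proof -
      have "slice (app X_op ?h) p' e' t'
          = app X_op (slice ?h p' e') t' + (if e' = 0 then 0 else slice ?h p' (e' - 1) t')"
        using fun_cong[OF slice_X[of ?h p' e'], of t'] by simp
      also have "\<dots> = (if p' = j then of_nat (Suc j choose e') * app (X_op ^ (Suc j - e')) g t' else 0)"
      proof (cases "e' = 0")
        case True
        then show ?thesis unfolding h h' by (simp add: app_scale)
      next
        case False
        then obtain d where d: "e' = Suc d" by (cases e') auto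
        consider "e' \<le> j" | "e' = Suc j" | "e' > Suc j" by linarith
        then show ?thesis
        proof cases
          case 1
          then have "j - d = Suc (j - Suc d)" using d by simp
          then show ?thesis unfolding h h' by (simp add: app_scale d algebra_simps)
        next
          case 2
          then have "d = j" using d by simp
          then show ?thesis unfolding h h' by (simp add: app_scale d binomial_eq_0)
        next
          case 3
          then show ?thesis unfolding h h' by (simp add: app_scale d binomial_eq_0)
        qed
      qed
      finally show ?thesis .
    qed
    show ?thesis
    proof (cases "p = 0")
      case True
      \<comment> \<open>No carry occurs: the vector sits at position \<open>j\<close>, and
        \<open>Suc j < q k\<close>.\<close>
      have "slice (app X_op ?h) (q k - 1) (q k - 1) = (\<lambda>s. 0)"
        using Suc.prems by (auto simp: X fun_eq_iff)
      then show ?thesis using fun_cong[OF slice_x[of q k "app X_op ?h" p e], of t] True by auto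
    next
      case False
      then show ?thesis
        using fun_cong[OF slice_x[of q k "app X_op ?h" p e], of t] X[of "p - 1" e t] Suc.prems by auto
    qed
  qed
  moreover have "app (x_op q k) (app X_op ?h) [] = 0" by (simp add: x_op.rep_eq)
  ultimately show ?case by (auto simp: fun_eq_iff split: list.splits)
qed

lemma xX_renormalization:
  assumes q: "1 < q k"
  shows "app ((x_op q k * X_op) ^ q k) (embed g) =
    (\<lambda>s. of_nat (q k) * embed (app (x_op q (Suc k) * X_op) g) s)"
proof -
  obtain r where r: "q k = Suc r" "0 < r" using q by (cases "q k") auto
  let ?h = "app ((x_op q k * X_op) ^ r) (embed g)"
  have h: "slice ?h p e
      = (if p = r then (\<lambda>t. of_nat (r choose e) * app (X_op ^ (r - e)) g t) else (\<lambda>t. 0))" for p e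
    by (subst xX_power_embed) (auto simp: r fun_eq_iff)
  have "app (x_op q k) (app X_op ?h) ((p, e) # t)
      = of_nat (q k) * embed (app (x_op q (Suc k) * X_op) g) ((p, e) # t)" for p e t
  proof (cases "p = 0")
    case False
    have "?h ((p - 1, e') # t) = 0" and "slice ?h (p - 1) e' = (\<lambda>s. 0)" if "p < q k" for e'
      using fun_cong[OF h[of "p - 1" e'], of t] h[of "p - 1" e'] that r False by auto
    then show ?thesis
      using fun_cong[OF slice_x[of q k "app X_op ?h" p e], of t] False
        fun_cong[OF slice_X[of ?h "p - 1" e], of t] by (auto simp: embed_def)
  next
    case True
    \<comment> \<open>At exponent \<open>r\<close>, \<open>X'\<close> contributes
      \<open>X' g\<close> once and \<open>z\<close>, from exponent \<open>r - 1\<close>, contributes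
      it \<open>r\<close> times: \<open>q k\<close> in total.\<close>
    have "(r choose (r - 1)) = r" using r binomial_symmetric[of 1 r] by simp
    then have "slice (app X_op ?h) r r = (\<lambda>s. of_nat (Suc r) * app X_op g s)"
      unfolding slice_X h using r by (auto simp: algebra_simps fun_cong[OF h])
    then show ?thesis
      using fun_cong[OF slice_x[of q k "app X_op ?h" p e], of t] True
      by (auto simp: r embed_def app_scale)
  qed
  moreover have "app (x_op q k) (app X_op ?h) [] = 0" by (simp add: x_op.rep_eq)
  ultimately have "app (x_op q k) (app X_op ?h) s
      = of_nat (q k) * embed (app (x_op q (Suc k) * X_op) g) s" for s
    by (cases s) (auto simp: embed_def)
  then show ?thesis by (simp add: r fun_eq_iff)
qed

lemma xX_renormalization_power:
  assumes "1 < q k"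
  shows "app ((x_op q k * X_op) ^ (q k * m)) (embed g) =
    (\<lambda>s. of_nat (q k) ^ m * embed (app ((x_op q (Suc k) * X_op) ^ m) g) s)"
proof (induction m)
  case (Suc m)
  have "app ((x_op q k * X_op) ^ (q k * Suc m)) (embed g)
      = app ((x_op q k * X_op) ^ q k) (app ((x_op q k * X_op) ^ (q k * m)) (embed g))"
    by (simp add: power_add)
  also have "\<dots> = (\<lambda>s. of_nat (q k) ^ m * app ((x_op q k * X_op) ^ q k)
      (embed (app ((x_op q (Suc k) * X_op) ^ m) g)) s)"
    by (simp only: Suc app_scale)
  also have "\<dots> = (\<lambda>s. of_nat (q k) ^ Suc m * embed (app ((x_op q (Suc k) * X_op) ^ Suc m) g) s)"
    by (simp add: xX_renormalization[of q k, OF assms] mult_ac)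
  finally show ?case .
qed simp

text \<open>A nonzero \<open>m\<close>-th power at level \<open>k + 1\<close> yields a nonzero power
  \<open>q k * m\<close> at level \<open>k\<close>, the factor \<open>q k ^ m\<close> being nonzero
  in the field. For \<open>m > 0\<close> this exponent is at least \<open>m + 1\<close>, which
  drives the induction over all levels at once.\<close>

lemma xX_power_nonzero:
  assumes q: "\<And>k. 1 < q k" and nz: "\<And>k. of_nat (q k) \<noteq> (0 :: 'k::field)"
  shows "\<exists>f :: state \<Rightarrow> 'k. (\<forall>s. pos q k s \<noteq> 0 \<longrightarrow> f s = 0) \<and>
           app ((x_op q k * X_op) ^ m) f \<noteq> (\<lambda>s. 0)"
proof (induction m arbitrary: k)
  case 0
  show ?case by (rule exI[of _ "\<lambda>s. if s = [] then 1 else 0"]) (auto simp: fun_eq_iff)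
next
  case (Suc m)
  show ?case
  proof (cases "m = 0")
    case True
    \<comment> \<open>Multiplying the exponent 0 by \<open>q k\<close> gains nothing, so the first
      power is computed directly: \<open>X_op\<close> raises the exponent to 1, \<open>x_op\<close>
      the position to 1.\<close>
    let ?f = "\<lambda>s. if s = [(0, 0)] then 1 else 0 :: 'k"
    have "app (x_op q k * X_op) ?f [(1, 1)] = 1"
      using q[of k] by (simp add: x_op.rep_eq X_op.rep_eq)
    then have "app (x_op q k * X_op) ?f \<noteq> (\<lambda>s. 0)" by (metis zero_neq_one)
    then show ?thesis using True by (intro exI[of _ ?f]) auto
  next
    case False
    obtain g :: "state \<Rightarrow> 'k" where g: "\<And>s. pos q (Suc k) s \<noteq> 0 \<Longrightarrow> g s = 0"
        "app ((x_op q (Suc k) * X_op) ^ m) g \<noteq> (\<lambda>s. 0)"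
      using Suc.IH by blast
    then obtain s where s: "app ((x_op q (Suc k) * X_op) ^ m) g s \<noteq> 0" by blast
    have "app ((x_op q k * X_op) ^ (q k * m)) (embed g) ((0, 0) # s) \<noteq> 0"
      unfolding xX_renormalization_power[of q k, OF q] using s nz by (simp add: embed_def)
    moreover have "Suc m \<le> q k * m" using False q[of k]
      by (metis Suc_leI mult_less_cancel2 nat_mult_1 neq0_conv)
    then have "(x_op q k * X_op) ^ (q k * m)
        = (x_op q k * X_op :: (state, 'k) rf_op) ^ (q k * m - Suc m) * (x_op q k * X_op) ^ Suc m"
      by (simp only: power_add[symmetric] le_add_diff_inverse2)
    ultimately have "app ((x_op q k * X_op) ^ Suc m) (embed g) \<noteq> (\<lambda>s. 0)"
      by (metis app_ring_simps(6) app_zero)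
    moreover have "\<forall>s. pos q k s \<noteq> 0 \<longrightarrow> embed g s = 0"
      using g(1) by (auto simp: embed_def split: list.splits)
    ultimately show ?thesis by blast
  qed
qed

section \<open>The generated subalgebra\<close>

text \<open>Generated without a unit, as local nilpotency demands.\<close>

inductive_set subalg :: "('s, 'k::field) rf_op set \<Rightarrow> ('s, 'k) rf_op set"
  for B :: "('s, 'k) rf_op set" where
  base: "T \<in> B \<Longrightarrow> T \<in> subalg B"
| zero: "0 \<in> subalg B"
| add: "T \<in> subalg B \<Longrightarrow> U \<in> subalg B \<Longrightarrow> T + U \<in> subalg B"
| scale: "T \<in> subalg B \<Longrightarrow> scalar c * T \<in> subalg B"
| mult: "T \<in> subalg B \<Longrightarrow> U \<in> subalg B \<Longrightarrow> T * U \<in> subalg B"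

lemma subalg_uminus: "T \<in> subalg B \<Longrightarrow> - T \<in> subalg B"
proof -
  have "- T = scalar (- 1) * T" by (rule op_eqI) simp
  then show "T \<in> subalg B \<Longrightarrow> - T \<in> subalg B" by (simp only: subalg.scale)
qed

lemma subalg_mono:
  assumes "B \<subseteq> C" "T \<in> subalg B"
  shows "T \<in> subalg C"
  using assms(2) by induction (use assms(1) in \<open>auto intro: subalg.intros\<close>)

lemma ad_mult: "ad X (T * U) = ad X T * U + T * ad X U"
  by (simp add: ad_def algebra_simps)

lemma ad_add: "ad X (T + U) = ad X T + ad X U"
  by (simp add: ad_def algebra_simps)

lemma ad_scale: "ad X (scalar c * T) = scalar c * ad X T"
proof -
  have "X * (scalar c * T) = scalar c * (X * T)"
    by (metis mult.assoc scalar_commute)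
  then show ?thesis by (simp add: ad_def algebra_simps)
qed

lemma ad_subalg:
  assumes "\<And>T. T \<in> B \<Longrightarrow> ad X T \<in> subalg B" "T \<in> subalg B"
  shows "ad X T \<in> subalg B"
  using assms(2)
proof induction
  case zero
  then show ?case by (simp add: ad_def subalg.zero)
next
  case (scale T c)
  then show ?case unfolding ad_scale by (intro subalg.scale)
qed (auto simp: ad_mult ad_add assms(1) intro: subalg.intros)

lemma subalg_range_finitary:
  fixes G :: "nat \<Rightarrow> ('s, 'k::field) rf_op"
  assumes "finite F" "F \<subseteq> subalg (range G)"
  shows "\<exists>n. F \<subseteq> subalg (G ` {..n})"
proof -
  have mono: "T \<in> subalg (G ` {..n})" if "T \<in> subalg (G ` {..m})" "m \<le> n" for T m n
    using that by (auto intro: subalg_mono[of "G ` {..m}"])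
  have single: "\<exists>n. T \<in> subalg (G ` {..n})" if "T \<in> subalg (range G)" for T
    using that
  proof induction
    case (base T)
    then obtain i where "T = G i" by blast
    then have "T \<in> subalg (G ` {..i})" by (auto intro: subalg.base)
    then show ?case ..
  next
    case (add T U)
    then obtain m n where "T \<in> subalg (G ` {..m})" "U \<in> subalg (G ` {..n})" by blast
    then have "T + U \<in> subalg (G ` {..max m n})"
      by (intro subalg.add) (auto elim: mono)
    then show ?case ..
  next
    case (mult T U)
    then obtain m n where "T \<in> subalg (G ` {..m})" "U \<in> subalg (G ` {..n})" by blast
    then have "T * U \<in> subalg (G ` {..max m n})"
      by (intro subalg.mult) (auto elim: mono)
    then show ?case ..
  qed (auto intro: subalg.zero subalg.scale)
  show ?thesis
    using assms
  proof induction
    case (insert T F)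
    then obtain m n where mn: "T \<in> subalg (G ` {..m})" "F \<subseteq> subalg (G ` {..n})"
      using single by blast
    then have "T \<in> subalg (G ` {..max m n})" "F \<subseteq> subalg (G ` {..max m n})"
      using mono[of _ _ "max m n"] by fastforce+
    then have "insert T F \<subseteq> subalg (G ` {..max m n})" by simp
    then show ?case ..
  qed simp
qed

lemma subalg_filtration:
  assumes F: "nil_filtration q 0 n t F" and T: "T \<in> subalg (gen q 0 ` {..n})" and "f \<in> F j"
  shows "app T f \<in> F (Suc j)"
  using T \<open>f \<in> F j\<close>
proof (induction arbitrary: f j)
  case (mult T U)
  then have "app T (app U f) \<in> F (Suc (Suc j))" by blast
  then show ?case using nil_filtrationD(3)[OF F] by simp
qed (auto intro: nil_filtrationD(4-7)[OF F])

lemma subalg_nilpotent: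
  fixes x :: "(state, 'k::field) rf_op" and F :: "nat \<Rightarrow> (state \<Rightarrow> 'k) set"
  assumes F: "nil_filtration q 0 n t F"
    and xs: "set xs \<subseteq> subalg (gen q 0 ` {..n})" "length xs = t"
  shows "foldl (*) x xs = 0"
proof -
  \<comment> \<open>The last factor acts first, hence the induction from the right; the head
    \<open>x\<close> finally receives a vector that is already 0.\<close>
  have *: "\<exists>g\<in>F (j + length ys). app (foldl (*) x ys) f = app x g"
    if "set ys \<subseteq> subalg (gen q 0 ` {..n})" "f \<in> F j" for ys and f :: "state \<Rightarrow> 'k" and j
    using that
  proof (induction ys arbitrary: f j rule: rev_induct)
    case (snoc y ys)
    then have "app y f \<in> F (Suc j)" using subalg_filtration[OF F] by simp
    then show ?case using snoc.IH[of "app y f" "Suc j"] snoc.prems by auto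
  qed auto
  show ?thesis
  proof (rule op_eqI)
    fix f :: "state \<Rightarrow> 'k" and s
    obtain g where g: "g \<in> F t" "app (foldl (*) x xs) f = app x g"
      using *[OF xs(1), of f 0] xs(2) nil_filtrationD(1)[OF F] by auto
    then have "g = (\<lambda>s. 0)" using nil_filtrationD(2)[OF F] by blast
    then show "app (foldl (*) x xs) f s = app 0 f s" using g by simp
  qed
qed

section \<open>Bounded shifts, and why \<open>x X\<close> has no quasi-inverse\<close>

lemma shifts_weaken:
  assumes "shifts q l u T" "l' \<le> l" "u \<le> u'"
  shows "shifts q l' u' T"
  unfolding shifts_def
proof (intro allI impI)
  fix f :: "state \<Rightarrow> 'a" and s
  assume f: "\<forall>t. pos q 0 t + l' \<le> pos q 0 s \<longrightarrow> pos q 0 s \<le> pos q 0 t + u' \<longrightarrow> f t = 0"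
  have "f t = 0" if "pos q 0 t + l \<le> pos q 0 s" "pos q 0 s \<le> pos q 0 t + u" for t
    using f that assms(2,3) by auto
  then show "app T f s = 0" using assms(1) unfolding shifts_def by blast
qed

lemma subalg_shifts:
  assumes q: "\<And>k. 0 < q k" and T: "T \<in> subalg (range (gen q 0))"
  shows "\<exists>u. shifts q 0 u T"
  using T
proof induction
  case (base T)
  then obtain i where "T = gen q 0 i" by blast
  then have "shifts q 1 1 T" using shifts_gen[of q, OF q] by simp
  then show ?case using shifts_weaken by blast
next
  case zero
  show ?case by (simp add: shifts_def)
next
  case (add T U)
  then obtain u v where "shifts q 0 u T" "shifts q 0 v U" by blast
  from shifts_add[OF this] show ?case by auto
next
  case (scale T c)
  then obtain u where "shifts q 0 u T" by blast
  from shifts_mult[OF shifts_scalar this] show ?case by auto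
next
  case (mult T U)
  then obtain u v where "shifts q 0 u T" "shifts q 0 v U" by blast
  from shifts_mult[OF this] show ?case by auto
qed

lemma app_sum: "app (\<Sum>i<(m::nat). T i) f s = (\<Sum>i<m. app (T i) f s)"
  by (induction m) simp_all

text \<open>The equation in the last hypothesis is \<open>a + b = a * b\<close> for \<open>a = x X\<close>, read off
  coefficientwise. It forces \<open>b = - (a + a^2 + a^3 + \<dots>)\<close>, but a polynomial \<open>b\<close> moves positions
  by a bounded amount while \<open>a ^ m\<close> moves them by exactly \<open>m\<close>.\<close>

lemma no_quasi_inverse:
  fixes b :: "nat \<Rightarrow> (state, 'k::field) rf_op"
  assumes q: "\<And>k. 1 < q k" and nz: "\<And>k. of_nat (q k) \<noteq> (0 :: 'k)"
    and b: "\<And>n. b n \<in> subalg (range (gen q 0))" and fin: "finite {n. b n \<noteq> 0}"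
    and eq: "\<And>n. (if n = 1 then x_op q 0 else 0) + b n =
      x_op q 0 * ad X_op (b n) + (if n = 0 then 0 else x_op q 0 * b (n - 1))"
  shows False
proof -
  have q0: "0 < q k" for k using q[of k] by simp
  let ?x = "x_op q 0 :: (state, 'k) rf_op" and ?X = "X_op :: (state, 'k) rf_op"
  define \<alpha> where "\<alpha> = ?x * ?X"
  obtain M where M: "\<And>n. b n \<noteq> 0 \<Longrightarrow> n < M" "1 < M"
  proof -
    obtain N where "\<forall>n\<in>{n. b n \<noteq> 0}. n < N" using fin finite_nat_set_iff_bounded by blast
    then show thesis by (intro that[of "N + 2"]) auto
  qed
  \<comment> \<open>The polynomial \<open>b\<close> evaluated at \<open>X_op\<close>. As
    \<open>b M = 0\<close>, the two index-shifted sums below agree and cancel.\<close>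
  define \<beta> where "\<beta> = (\<Sum>n<Suc M. b n * ?X ^ n)"
  have "\<alpha> * \<beta> = (\<Sum>n<Suc M. ?x * ad ?X (b n) * ?X ^ n + ?x * b n * ?X ^ Suc n)"
    unfolding \<beta>_def \<alpha>_def sum_distrib_left
    by (intro sum.cong) (simp_all add: ad_def algebra_simps)
  also have "\<dots> = (\<Sum>n<Suc M. ((if n = 1 then ?x else 0) + b n
      - (if n = 0 then 0 else ?x * b (n - 1))) * ?X ^ n + ?x * b n * ?X ^ Suc n)"
    by (intro sum.cong refl) (simp only: eq add_diff_cancel_right')
  also have "\<dots> = (\<Sum>n<Suc M. (if n = 1 then ?x else 0) * ?X ^ n) + \<beta>
      - (\<Sum>n<Suc M. (if n = 0 then 0 else ?x * b (n - 1)) * ?X ^ n)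
      + (\<Sum>n<Suc M. ?x * b n * ?X ^ Suc n)"
    by (simp only: \<beta>_def ring_distribs sum.distrib sum_subtractf)
  also have "(\<Sum>n<Suc M. (if n = 1 then ?x else 0) * ?X ^ n) = \<alpha>"
  proof -
    have "(\<Sum>n<Suc M. (if n = 1 then ?x else 0) * ?X ^ n)
        = (\<Sum>n<Suc M. if n = 1 then ?x * ?X ^ n else 0)"
      by (intro sum.cong) auto
    then show ?thesis using M(2) by (simp add: \<alpha>_def)
  qed
  also have "(\<Sum>n<Suc M. (if n = 0 then 0 else ?x * b (n - 1)) * ?X ^ n)
      = (\<Sum>n<M. ?x * b n * ?X ^ Suc n)"
    by (subst sum.lessThan_Suc_shift) simp
  also have "(\<Sum>n<Suc M. ?x * b n * ?X ^ Suc n) = (\<Sum>n<M. ?x * b n * ?X ^ Suc n)"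
  proof -
    have "b M = 0" using M(1)[of M] by auto
    then show ?thesis by simp
  qed
  finally have "\<alpha> * \<beta> = \<alpha> + \<beta>" by simp
  then have \<beta>: "\<beta> = \<alpha> * \<beta> - \<alpha>" by simp
  have iter: "\<beta> = \<alpha> ^ m * \<beta> - (\<Sum>i<m. \<alpha> ^ Suc i)" for m
  proof (induction m)
    case (Suc m)
    have "\<beta> = \<alpha> ^ m * (\<alpha> * \<beta> - \<alpha>) - (\<Sum>i<m. \<alpha> ^ Suc i)" using \<beta> Suc by simp
    also have "\<alpha> ^ m * (\<alpha> * \<beta> - \<alpha>) = \<alpha> ^ Suc m * \<beta> - \<alpha> ^ Suc m"
      by (simp add: right_diff_distrib power_commutes mult.assoc[symmetric])
    finally show ?case by (simp add: diff_diff_add add.commute)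
  qed simp
  have "\<exists>u. shifts q 0 u (\<Sum>n<N. b n * ?X ^ n)" for N
  proof (induction N)
    case (Suc N)
    then obtain u where u: "shifts q 0 u (\<Sum>n<N. b n * ?X ^ n)" by blast
    obtain v where v: "shifts q 0 v (b N)" using subalg_shifts[of q, OF q0 b] by blast
    show ?case
      using shifts_add[OF u shifts_mult[OF v shifts_power[OF shifts_X, of q N]]] by auto
  qed (simp add: shifts_def)
  then obtain u where u: "shifts q 0 u \<beta>" unfolding \<beta>_def by blast
  have \<alpha>: "shifts q m m (\<alpha> ^ m)" for m
    using shifts_power[OF shifts_mult[OF shifts_x[of q, OF q0] shifts_X], where m
        = m] by (simp add: \<alpha>_def)
  \<comment> \<open>From position 0, \<open>\<beta>\<close> cannot reach position
    \<open>u + 1\<close>, and \<open>\<alpha> ^ Suc m * \<beta>\<close> overshoots it. Of the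
    identity \<open>iter\<close> only \<open>\<alpha> ^ m\<close> survives there, so it must
    vanish.\<close>
  define m where "m = Suc u"
  obtain f :: "state \<Rightarrow> 'k" where f: "\<And>s. pos q 0 s \<noteq> 0 \<Longrightarrow> f s = 0"
      "app (\<alpha> ^ m) f \<noteq> (\<lambda>s. 0)"
    using xX_power_nonzero[where q = q and k = 0 and m = m, OF q nz] unfolding \<alpha>_def by blast
  have away: "app (\<alpha> ^ i) f s = 0" if "pos q 0 s \<noteq> i" for i s
    using \<alpha>[of i] f(1) that unfolding shifts_def by (metis add.left_neutral le_antisym)
  have "app (\<alpha> ^ m) f s = 0" for s
  proof (cases "pos q 0 s = m")
    case True
    have "app \<beta> f s = 0"
      using u f(1) True unfolding shifts_def m_def by (metis add.left_neutral not_less_eq_eq order_refl)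
    moreover have "app (\<alpha> ^ Suc m) (app \<beta> f) s = 0"
      using \<alpha>[of "Suc m"] True unfolding shifts_def by auto
    moreover have "app (\<Sum>i<Suc m. \<alpha> ^ Suc i) f s = app (\<alpha> ^ m) f s"
    proof -
      have "(\<Sum>i<Suc m. app (\<alpha> ^ Suc i) f s) = (\<Sum>i<Suc m. if i = u then app (\<alpha> ^ m) f s else 0)"
        using away True by (intro sum.cong) (auto simp: m_def simp del: power_Suc)
      then show ?thesis by (simp only: app_sum) (simp add: m_def del: power_Suc)
    qed
    moreover have "app \<beta> f s = app (\<alpha> ^ Suc m) (app \<beta> f) s - app (\<Sum>i<Suc m. \<alpha> ^ Suc i) f s"
      by (subst iter[of "Suc m"]) (simp only: app_ring_simps)
    ultimately show ?thesis by simp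
  qed (rule away)
  then show False using f(2) by auto
qed

section \<open>Transport to the carrier type\<close>

definition transport_alg :: "(('s, 'k::field) rf_op \<Rightarrow> 'r) \<Rightarrow> ('s, 'k) rf_op set \<Rightarrow> ('k, 'r) kalg" where
  "transport_alg h A = \<lparr>carr = h ` A, pls = \<lambda>a b. h (inv h a + inv h b),
     tms = \<lambda>a b. h (inv h a * inv h b), zr = h 0, sm = \<lambda>c a. h (scalar c * inv h a)\<rparr>"

lemma transport_alg_sel [simp]:
  "carr (transport_alg h A) = h ` A" "pls (transport_alg h A) a b = h (inv h a + inv h b)"
  "tms (transport_alg h A) a b = h (inv h a * inv h b)" "zr (transport_alg h A) = h 0"
  "sm (transport_alg h A) c a = h (scalar c * inv h a)"
  by (simp_all add: transport_alg_def)

lemma scalar_mult_distribs: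
  "scalar (c + e) * T = scalar c * T + scalar e * T" "scalar (c * e) * T = scalar c * (scalar e * T)"
  "scalar 1 * T = T"
  by (auto intro!: op_eqI simp: algebra_simps)

lemma is_kalg_transport_subalg:
  assumes h: "inj h"
  shows "is_kalg (transport_alg h (subalg B))"
proof -
  have neg: "\<exists>U\<in>subalg B. h (T + U) = h 0" if "T \<in> subalg B" for T
    using subalg_uminus[OF that] by (intro bexI[of _ "- T"]) simp_all
  have comm: "scalar c * (T * U) = T * (scalar c * U)" for c and T U :: "('a, 'b) rf_op"
    by (metis mult.assoc scalar_commute)
  show ?thesis (is "is_kalg ?R")
    unfolding is_kalg_def
  proof (intro conjI)
    show "\<forall>c. \<forall>a\<in>carr ?R. \<forall>b\<in>carr ?R. sm ?R c (tms ?R a b) = tms ?R (sm ?R c a) b \<and>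
        sm ?R c (tms ?R a b) = tms ?R a (sm ?R c b)"
      by (auto simp: inv_f_f[OF h] mult.assoc comm)
  qed (auto simp: inv_f_f[OF h] neg algebra_simps scalar_mult_distribs intro: subalg.intros)
qed

lemma is_derivation_transport_ad:
  assumes h: "inj h" and "\<And>T. T \<in> B \<Longrightarrow> ad X T \<in> subalg B"
  shows "is_derivation (transport_alg h (subalg B)) (\<lambda>a. h (ad X (inv h a)))"
    (is "is_derivation ?R ?D")
  unfolding is_derivation_def
proof (intro conjI)
  show "\<forall>a\<in>carr ?R. ?D a \<in> carr ?R"
    using ad_subalg[OF assms(2)] by (auto simp: inv_f_f[OF h])
  show "\<forall>c. \<forall>a\<in>carr ?R. ?D (sm ?R c a) = sm ?R c (?D a)"
    by (auto simp: inv_f_f[OF h] ad_scale)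
qed (auto simp: inv_f_f[OF h] ad_mult ad_add)

lemma locally_nilpotent_transport:
  fixes h :: "(state, 'k::field) rf_op \<Rightarrow> 'r"
  assumes h: "inj h" and q: "\<And>k. 2 * k + 2 \<le> q k"
  shows "locally_nilpotent (transport_alg h (subalg (range (gen q 0))))"
    (is "locally_nilpotent ?R")
  unfolding locally_nilpotent_def
proof (intro allI impI)
  fix F assume "finite F \<and> F \<subseteq> carr ?R"
  then obtain F' where F': "finite F'" "F' \<subseteq> subalg (range (gen q 0))" "F = h ` F'"
    using finite_subset_image[of F h "subalg (range (gen q 0))"] by auto
  then obtain n where n: "F' \<subseteq> subalg (gen q 0 ` {..n})" using subalg_range_finitary by blast
  let ?A = "subalg (gen q 0 ` {..n}) :: (state, 'k) rf_op set"
  obtain t and Fil :: "nat \<Rightarrow> (state \<Rightarrow> 'k) set" where Fil: "nil_filtration q 0 n t Fil"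
    using ex_nil_filtration[OF q] by blast
  have "b \<in> h ` ?A" if a: "a \<in> ?A" and b: "b \<in> carr ?R" "h (a + inv h b) = h 0" for a b
  proof -
    obtain T where "b = h T" using b by auto
    moreover have "T = - a"
      using b \<open>b = h T\<close> h by (simp add: inv_f_f[OF h] inj_eq eq_neg_iff_add_eq_0 add.commute)
    ultimately show ?thesis using subalg_uminus[OF a] by blast
  qed
  moreover have "?A \<subseteq> subalg (range (gen q 0))"
    by (auto intro: subalg_mono[of "gen q 0 ` {..n}"])
  \<comment> \<open>The subalgebra contains the generated subring, so its nilpotency
    suffices.\<close>
  ultimately have "h ` ?A \<in> {S. F \<subseteq> S \<and> S \<subseteq> carr ?R \<and> zr ?R \<in> S \<and>
      (\<forall>a\<in>S. \<forall>b\<in>S. pls ?R a b \<in> S \<and> tms ?R a b \<in> S) \<and>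
      (\<forall>a\<in>S. \<forall>b\<in>carr ?R. pls ?R a b = zr ?R \<longrightarrow> b \<in> S)}"
    using F' n
    by (auto simp: inv_f_f[OF h] intro: subalg.intros)
  then have sub: "subring_gen ?R F \<subseteq> h ` ?A" unfolding subring_gen_def by (rule Inter_lower)
  have "foldl (tms ?R) x xs = zr ?R"
    if x: "x \<in> subring_gen ?R F" and xs: "set xs \<subseteq> subring_gen ?R F" "length xs = t" for x xs
  proof -
    have "foldl (tms ?R) (h T) (map h Ts) = h (foldl (*) T Ts)" for T Ts
      by (induction Ts arbitrary: T) (simp_all add: inv_f_f[OF h])
    moreover obtain T where "x = h T" using x sub by blast
    moreover obtain Ts where Ts: "xs = map h Ts" "set Ts \<subseteq> ?A"
    proof (rule that[of "map (inv h) xs"])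
      have "x = h (inv h x) \<and> inv h x \<in> ?A" if "x \<in> set xs" for x
        using that xs(1) sub by (auto simp: inv_f_f[OF h])
      then show "xs = map h (map (inv h) xs)" "set (map (inv h) xs) \<subseteq> ?A"
        by (auto simp: map_idI)
    qed
    ultimately show ?thesis using subalg_nilpotent[OF Fil Ts(2)] xs(2) by simp
  qed
  then show "nilpotent_set ?R (subring_gen ?R F)" unfolding nilpotent_set_def by blast
qed

lemma inv_fsum:
  assumes "inj h"
  shows "inv h (fsum (transport_alg h A) f n) = (\<Sum>i<n. inv h (f i))"
  by (induction n) (simp_all add: inv_f_f[OF assms])

lemma inv_nsm:
  assumes "inj h"
  shows "inv h (nsm (transport_alg h A) m a) = of_nat m * inv h a"
  unfolding nsm_def by (induction m) (simp_all add: inv_f_f[OF assms] algebra_simps)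

text \<open>This is \<open>x X b X^n = x b X^(n+1) + x D(b) X^n\<close> by coefficients;
  \<open>x \<noteq> 0\<close> makes \<open>supp_bound\<close> equal to 2.\<close>

lemma inv_ore_mul_monomial:
  fixes h :: "('s, 'k::field) rf_op \<Rightarrow> 'r"
  assumes h: "inj h" and "x \<noteq> 0"
  shows "inv h (ore_mul (transport_alg h A) (\<lambda>a. h (ad X (inv h a)))
      (\<lambda>i. if i = 1 then h x else h 0) b n) =
    x * ad X (inv h (b n)) + (if n = 0 then 0 else x * inv h (b (n - 1)))"
proof -
  let ?R = "transport_alg h A" and ?D = "\<lambda>a. h (ad X (inv h a))"
  let ?a = "\<lambda>i::nat. if i = 1 then h x else h 0"
  have "supp_bound ?R ?a = 2"
    unfolding supp_bound_def
  proof (rule Least_equality)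
    fix N assume "\<forall>i\<ge>N. ?a i = zr ?R"
    then have "\<not> N \<le> 1" using assms by (auto simp: inj_eq)
    then show "2 \<le> N" by simp
  qed simp
  then have "inv h (ore_mul ?R ?D ?a b n) = (\<Sum>i<2. \<Sum>j<Suc n.
      if n \<le> i + j then of_nat (i choose (i + j - n)) *
        (inv h (?a i) * inv h ((?D ^^ (i + j - n)) (b j))) else 0)"
    unfolding ore_mul_def inv_fsum[OF h]
    by (intro sum.cong refl) (auto simp: inv_nsm[OF h] inv_f_f[OF h])
  also have "\<dots> = (\<Sum>j<Suc n. if n \<le> 1 + j then of_nat (1 choose (1 + j - n)) *
        (x * inv h ((?D ^^ (1 + j - n)) (b j))) else 0)"
    by (simp add: numeral_2_eq_2 inv_f_f[OF h] cong: if_cong)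
  also have "\<dots> = x * ad X (inv h (b n)) + (if n = 0 then 0 else x * inv h (b (n - 1)))"
  proof (cases n)
    case (Suc m)
    have "(\<Sum>j<m. if n \<le> 1 + j then of_nat (1 choose (1 + j - n)) *
        (x * inv h ((?D ^^ (1 + j - n)) (b j))) else 0) = 0"
      by (intro sum.neutral) (auto simp: Suc)
    then show ?thesis by (simp add: Suc inv_f_f[OF h] add.commute)
  qed (simp add: inv_f_f[OF h])
  finally show ?thesis .
qed

theorem mainTheorem11:
  shows "\<exists>(R :: ('k::field, 'k list set) kalg) D.
           is_kalg R \<and> locally_nilpotent R \<and> is_derivation R D \<and>
           ore_jacobson R D \<noteq> ore_carrier R"
proof -
  \<comment> \<open>Consecutive integers cannot both vanish in a field, so in every characteristic
    one of these lengths is nonzero, and both are long enough for the filtration.\<close>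
  define q :: "nat \<Rightarrow> nat" where
    "q k = (if of_nat (2 * k + 2) = (0 :: 'k) then 2 * k + 3 else 2 * k + 2)" for k
  have q: "2 * k + 2 \<le> q k" for k by (simp add: q_def)
  have q1: "1 < q k" for k using q[of k] by simp
  have nz: "of_nat (q k) \<noteq> (0 :: 'k)" for k
  proof (cases "of_nat (2 * k + 2) = (0 :: 'k)")
    case True
    have "2 * k + 3 = Suc (2 * k + 2)" by simp
    then have "of_nat (2 * k + 3) = (1 :: 'k)" by (simp only: of_nat_Suc True add_0_right)
    then show ?thesis unfolding q_def if_P[OF True] by (simp only: one_neq_zero not_False_eq_True)
  next
    case False
    then show ?thesis unfolding q_def if_not_P[OF False] .
  qed
  obtain h :: "(state, 'k) rf_op \<Rightarrow> 'k list set" where h: "inj h" using ex_inj_rf_op by blast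
  let ?B = "range (gen q 0) :: (state, 'k) rf_op set"
  let ?R = "transport_alg h (subalg ?B)" and ?D = "\<lambda>a. h (ad X_op (inv h a))"
  let ?x = "x_op q 0 :: (state, 'k) rf_op"
  have D: "ad X_op T \<in> subalg ?B" if T: "T \<in> ?B" for T
  proof -
    obtain i where "T = gen q 0 i" using T by blast
    then have "ad X_op T = gen q 0 (Suc i)" by (simp add: gen_Suc ad_def)
    then show ?thesis by (auto intro: subalg.base)
  qed
  have x0: "?x \<noteq> 0"
    using xX_power_nonzero[where q = q and k = 0 and m = 1, OF q1 nz] by auto
  have "ore_jacobson ?R ?D \<noteq> ore_carrier ?R"
  proof
    assume J: "ore_jacobson ?R ?D = ore_carrier ?R"
    \<comment> \<open>The monomial \<open>x X\<close>; a radical equal to the whole ring would make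
      it quasi-regular.\<close>
    let ?a = "\<lambda>i::nat. if i = 1 then h ?x else h 0"
    have "?x \<in> subalg ?B" by (metis gen_0 rangeI subalg.base)
    moreover have "finite {i. ?a i \<noteq> h 0}" by (rule finite_subset[of _ "{1}"]) auto
    ultimately have "?a \<in> ore_carrier ?R" by (auto simp: ore_carrier_def intro: subalg.zero)
    then have "ore_rqr ?R ?D ?a" using J unfolding ore_jacobson_def by blast
    then obtain b where b: "b \<in> ore_carrier ?R" "ore_add ?R ?a b = ore_mul ?R ?D ?a b"
      unfolding ore_rqr_def by blast
    show False
    proof (rule no_quasi_inverse[of q "\<lambda>n. inv h (b n)", OF q1 nz])
      show "inv h (b n) \<in> subalg ?B" for n
        using b(1) by (auto simp: ore_carrier_def inv_f_f[OF h] dest!: spec[of _ n])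
      have "{n. inv h (b n) \<noteq> 0} \<subseteq> {n. b n \<noteq> zr ?R}" by (auto simp: inv_f_f[OF h])
      then show "finite {n. inv h (b n) \<noteq> 0}"
        by (rule finite_subset) (use b(1) in \<open>simp add: ore_carrier_def\<close>)
      fix n
      have "(if n = 1 then ?x else 0) + inv h (b n) = inv h (ore_add ?R ?a b n)"
        by (simp add: ore_add_def inv_f_f[OF h])
      then show "(if n = 1 then ?x else 0) + inv h (b n) =
          ?x * ad X_op (inv h (b n)) + (if n = 0 then 0 else ?x * inv h (b (n - 1)))"
        unfolding b(2) inv_ore_mul_monomial[OF h x0] .
    qed
  qed
  with is_kalg_transport_subalg[OF h] locally_nilpotent_transport[of h q, OF h q]
    is_derivation_transport_ad[OF h D]
  have "is_kalg ?R \<and> locally_nilpotent ?R \<and> is_derivation ?R ?D \<and>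
      ore_jacobson ?R ?D \<noteq> ore_carrier ?R"
    by (intro conjI)
  then show ?thesis by blast
qed

end
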